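(* Up to isomorphism, there are exactly three distinct 2-cell embeddings of the multigraph $\Theta_5$ on the double torus.
   Context: $\Theta_5$ denotes the multigraph with two vertices $u,v$ and five parallel edges between them (no loops). The double torus is the orientable surface of genus 2. A 2-cell embedding (every face homeomorphic to an open disc) of a multigraph $G$ on an orientable surface is described by a rotation system $\tau$: for each vertex, a cyclic ordering of its incident edges; the rotation system determines the facial boundaries and hence the embedding, denoted $G^\tau$. Two embeddings $G^{\tau_1}, G^{\tau_2}$ are isomorphic if some permutation of the vertices and of the edges of $G$ (preserving incidence) transforms $\tau_1$ into $\tau_2$. *)

theory Defs
  imports "HOL-Combinatorics.Combinatorics"
begin

section \<open>Multigraphs\<close>

record ('v, 'e) multigraph =
  verts :: "'v set"
  edges :: "'e set"
  ends :: "'e \<Rightarrow> 'v set"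

definition loopless_multigraph :: "('v, 'e) multigraph \<Rightarrow> bool" where
  "loopless_multigraph G \<longleftrightarrow>
     finite (verts G) \<and> finite (edges G) \<and>
     (\<forall>e\<in>edges G. ends G e \<subseteq> verts G \<and> card (ends G e) = 2)"

definition incident_edges :: "('v, 'e) multigraph \<Rightarrow> 'v \<Rightarrow> 'e set" where
  "incident_edges G v = {e \<in> edges G. v \<in> ends G e}"

definition connected_multigraph :: "('v, 'e) multigraph \<Rightarrow> bool" where
  "connected_multigraph G \<longleftrightarrow>
     verts G \<noteq> {} \<and>
     (\<forall>x\<in>verts G. \<forall>y\<in>verts G. (x, y) \<in> {(a, b). \<exists>e\<in>edges G. ends G e = {a, b}}\<^sup>*)"

section \<open>Rotation systems and their facial boundaries\<close>

text \<open>The value \<open>\<tau> v e\<close> is the edge that follows \<open>e\<close> in the cyclic order around \<open>v\<close>.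
  Outside the incident pairs \<open>\<tau>\<close> is the identity, so that distinct functions are distinct
  rotation systems. By definition of \<^const>\<open>cyclic_on\<close>, isolated vertices admit no rotation.\<close>

definition rotation_system :: "('v, 'e) multigraph \<Rightarrow> ('v \<Rightarrow> 'e \<Rightarrow> 'e) \<Rightarrow> bool" where
  "rotation_system G \<tau> \<longleftrightarrow>
     (\<forall>v\<in>verts G. \<tau> v permutes incident_edges G v \<and> cyclic_on (\<tau> v) (incident_edges G v)) \<and>
     (\<forall>v. v \<notin> verts G \<longrightarrow> \<tau> v = id)"

text \<open>The dart \<open>(v, e)\<close> is the edge \<open>e\<close> traversed starting from its end \<open>v\<close>.\<close>

definition darts :: "('v, 'e) multigraph \<Rightarrow> ('v \<times> 'e) set" where
  "darts G = {(v, e). e \<in> edges G \<and> v \<in> ends G e}"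

definition other_end :: "('v, 'e) multigraph \<Rightarrow> 'v \<Rightarrow> 'e \<Rightarrow> 'v" where
  "other_end G v e = the_elem (ends G e - {v})"

text \<open>Face tracing: traverse \<open>e\<close> from \<open>v\<close> to its other end \<open>w\<close>, and leave \<open>w\<close> along the edge
  following \<open>e\<close> in the rotation at \<open>w\<close>. The facial boundaries are the closed walks obtained in
  this way, that is, the orbits of this permutation of the darts.\<close>

definition face_step :: "('v, 'e) multigraph \<Rightarrow> ('v \<Rightarrow> 'e \<Rightarrow> 'e) \<Rightarrow> 'v \<times> 'e \<Rightarrow> 'v \<times> 'e" where
  "face_step G \<tau> = (\<lambda>(v, e). (other_end G v e, \<tau> (other_end G v e) e))"

definition faces :: "('v, 'e) multigraph \<Rightarrow> ('v \<Rightarrow> 'e \<Rightarrow> 'e) \<Rightarrow> ('v \<times> 'e) set set" where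
  "faces G \<tau> = orbit (face_step G \<tau>) ` darts G"

text \<open>Gluing an open disc to each facial boundary yields a closed orientable surface, whose
  genus \<open>g\<close> is given by the Euler formula. Isolated vertices being excluded, every face has a
  dart on its boundary.\<close>

definition two_cell_embedding ::
  "('v, 'e) multigraph \<Rightarrow> nat \<Rightarrow> ('v \<Rightarrow> 'e \<Rightarrow> 'e) \<Rightarrow> bool" where
  "two_cell_embedding G g \<tau> \<longleftrightarrow>
     loopless_multigraph G \<and> connected_multigraph G \<and> rotation_system G \<tau> \<and>
     int (card (verts G)) - int (card (edges G)) + int (card (faces G \<tau>)) = 2 - 2 * int g"

section \<open>Isomorphism of embeddings\<close>

text \<open>No reversal of the orientation is built in: the rotations of \<open>\<tau>\<^sub>1\<close> are carried to those
  of \<open>\<tau>\<^sub>2\<close>, not to their inverses.\<close>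

definition isomorphic_embeddings ::
  "('v, 'e) multigraph \<Rightarrow> ('v \<Rightarrow> 'e \<Rightarrow> 'e) \<Rightarrow> ('v \<Rightarrow> 'e \<Rightarrow> 'e) \<Rightarrow> bool" where
  "isomorphic_embeddings G \<tau>\<^sub>1 \<tau>\<^sub>2 \<longleftrightarrow>
     (\<exists>\<pi> \<rho>. \<pi> permutes verts G \<and> \<rho> permutes edges G \<and>
        (\<forall>e\<in>edges G. ends G (\<rho> e) = \<pi> ` ends G e) \<and>
        (\<forall>v\<in>verts G. \<forall>e\<in>incident_edges G v. \<tau>\<^sub>2 (\<pi> v) (\<rho> e) = \<rho> (\<tau>\<^sub>1 v e)))"

definition embeddings :: "('v, 'e) multigraph \<Rightarrow> nat \<Rightarrow> ('v \<Rightarrow> 'e \<Rightarrow> 'e) set" where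
  "embeddings G g = {\<tau>. two_cell_embedding G g \<tau>}"

definition embedding_iso_rel ::
  "('v, 'e) multigraph \<Rightarrow> nat \<Rightarrow> (('v \<Rightarrow> 'e \<Rightarrow> 'e) \<times> ('v \<Rightarrow> 'e \<Rightarrow> 'e)) set" where
  "embedding_iso_rel G g =
     {(\<tau>\<^sub>1, \<tau>\<^sub>2). \<tau>\<^sub>1 \<in> embeddings G g \<and> \<tau>\<^sub>2 \<in> embeddings G g \<and> isomorphic_embeddings G \<tau>\<^sub>1 \<tau>\<^sub>2}"

lemma isomorphic_embeddings_refl: "isomorphic_embeddings G \<tau> \<tau>"
  unfolding isomorphic_embeddings_def
  by (intro exI[of _ id]) (auto simp: permutes_id)

lemma isomorphic_embeddingsE:
  assumes "isomorphic_embeddings G \<tau>\<^sub>1 \<tau>\<^sub>2"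
  obtains \<pi> \<rho> where "\<pi> permutes verts G" "\<rho> permutes edges G"
    "\<And>e. e \<in> edges G \<Longrightarrow> ends G (\<rho> e) = \<pi> ` ends G e"
    "\<And>v e. v \<in> verts G \<Longrightarrow> e \<in> incident_edges G v \<Longrightarrow> \<tau>\<^sub>2 (\<pi> v) (\<rho> e) = \<rho> (\<tau>\<^sub>1 v e)"
proof -
  from assms obtain \<pi> \<rho> where *: "\<pi> permutes verts G \<and> \<rho> permutes edges G \<and>
      (\<forall>e\<in>edges G. ends G (\<rho> e) = \<pi> ` ends G e) \<and>
      (\<forall>v\<in>verts G. \<forall>e\<in>incident_edges G v. \<tau>\<^sub>2 (\<pi> v) (\<rho> e) = \<rho> (\<tau>\<^sub>1 v e))"
    unfolding isomorphic_embeddings_def by (elim exE)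
  show thesis
    by (rule that[of \<pi> \<rho>]) (simp_all add: *)
qed

lemma isomorphic_embeddings_trans:
  assumes "isomorphic_embeddings G \<tau>\<^sub>1 \<tau>\<^sub>2" "isomorphic_embeddings G \<tau>\<^sub>2 \<tau>\<^sub>3"
  shows "isomorphic_embeddings G \<tau>\<^sub>1 \<tau>\<^sub>3"
proof -
  obtain \<pi> \<rho> where 1: "\<pi> permutes verts G" "\<rho> permutes edges G"
      "\<And>e. e \<in> edges G \<Longrightarrow> ends G (\<rho> e) = \<pi> ` ends G e"
      "\<And>v e. v \<in> verts G \<Longrightarrow> e \<in> incident_edges G v \<Longrightarrow> \<tau>\<^sub>2 (\<pi> v) (\<rho> e) = \<rho> (\<tau>\<^sub>1 v e)"
    by (rule isomorphic_embeddingsE[OF assms(1)]) (rule that, simp_all)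
  obtain \<pi>' \<rho>' where 2: "\<pi>' permutes verts G" "\<rho>' permutes edges G"
      "\<And>e. e \<in> edges G \<Longrightarrow> ends G (\<rho>' e) = \<pi>' ` ends G e"
      "\<And>v e. v \<in> verts G \<Longrightarrow> e \<in> incident_edges G v \<Longrightarrow> \<tau>\<^sub>3 (\<pi>' v) (\<rho>' e) = \<rho>' (\<tau>\<^sub>2 v e)"
    by (rule isomorphic_embeddingsE[OF assms(2)]) (rule that, simp_all)
  have inc: "\<rho> e \<in> incident_edges G (\<pi> v)" if "e \<in> incident_edges G v" for v e
    using that 1(3) permutes_in_image[OF 1(2)] by (auto simp: incident_edges_def)
  have "(\<pi>' \<circ> \<pi>) permutes verts G" "(\<rho>' \<circ> \<rho>) permutes edges G"
    by (rule permutes_compose[OF 1(1) 2(1)], rule permutes_compose[OF 1(2) 2(2)])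
  moreover have "\<forall>e\<in>edges G. ends G ((\<rho>' \<circ> \<rho>) e) = (\<pi>' \<circ> \<pi>) ` ends G e"
    using 1(3) 2(3) permutes_in_image[OF 1(2)] by (simp add: image_comp)
  moreover have "\<forall>v\<in>verts G. \<forall>e\<in>incident_edges G v.
      \<tau>\<^sub>3 ((\<pi>' \<circ> \<pi>) v) ((\<rho>' \<circ> \<rho>) e) = (\<rho>' \<circ> \<rho>) (\<tau>\<^sub>1 v e)"
    using 1(4) 2(4) inc permutes_in_image[OF 1(1)] by simp
  ultimately show ?thesis
    unfolding isomorphic_embeddings_def
    by (intro exI[of _ "\<pi>' \<circ> \<pi>"] exI[of _ "\<rho>' \<circ> \<rho>"] conjI)
qed

lemma isomorphic_embeddings_sym:
  assumes "isomorphic_embeddings G \<tau>\<^sub>1 \<tau>\<^sub>2"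
  shows "isomorphic_embeddings G \<tau>\<^sub>2 \<tau>\<^sub>1"
proof -
  obtain \<pi> \<rho> where 1: "\<pi> permutes verts G" "\<rho> permutes edges G"
      "\<And>e. e \<in> edges G \<Longrightarrow> ends G (\<rho> e) = \<pi> ` ends G e"
      "\<And>v e. v \<in> verts G \<Longrightarrow> e \<in> incident_edges G v \<Longrightarrow> \<tau>\<^sub>2 (\<pi> v) (\<rho> e) = \<rho> (\<tau>\<^sub>1 v e)"
    by (rule isomorphic_embeddingsE[OF assms]) (rule that, simp_all)
  have \<pi>: "inv \<pi> permutes verts G" and \<rho>: "inv \<rho> permutes edges G"
    by (rule permutes_inv[OF 1(1)], rule permutes_inv[OF 1(2)])
  have ends: "ends G (inv \<rho> e) = inv \<pi> ` ends G e" if "e \<in> edges G" for e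
  proof -
    have "ends G e = \<pi> ` ends G (inv \<rho> e)"
      using 1(3)[of "inv \<rho> e"] permutes_in_image[OF \<rho>] that permutes_inverses(1)[OF 1(2)] by simp
    then show ?thesis
      using permutes_inj[OF 1(1)] by (simp add: image_inv_f_f)
  qed
  have rot: "\<tau>\<^sub>1 (inv \<pi> v) (inv \<rho> e) = inv \<rho> (\<tau>\<^sub>2 v e)"
    if "v \<in> verts G" "e \<in> incident_edges G v" for v e
  proof -
    have "inv \<pi> v \<in> verts G" "inv \<rho> e \<in> incident_edges G (inv \<pi> v)"
      using that ends permutes_in_image[OF \<pi>] permutes_in_image[OF \<rho>]
      by (auto simp: incident_edges_def)
    from 1(4)[OF this] have "\<tau>\<^sub>2 v e = \<rho> (\<tau>\<^sub>1 (inv \<pi> v) (inv \<rho> e))"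
      using permutes_inverses(1)[OF 1(1)] permutes_inverses(1)[OF 1(2)] by simp
    then show ?thesis
      using permutes_inverses(2)[OF 1(2)] by simp
  qed
  show ?thesis
    unfolding isomorphic_embeddings_def
    by (intro exI[of _ "inv \<pi>"] exI[of _ "inv \<rho>"] conjI ballI \<pi> \<rho> ends rot)
qed

lemma equiv_embedding_iso_rel: "equiv (embeddings G g) (embedding_iso_rel G g)"
proof (rule equivI)
  show "embedding_iso_rel G g \<subseteq> embeddings G g \<times> embeddings G g"
    by (auto simp: embedding_iso_rel_def)
  show "refl_on (embeddings G g) (embedding_iso_rel G g)"
    by (auto simp: refl_on_def embedding_iso_rel_def isomorphic_embeddings_refl)
  show "sym (embedding_iso_rel G g)"
    by (rule symI) (simp add: embedding_iso_rel_def isomorphic_embeddings_sym)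
  show "trans (embedding_iso_rel G g)"
  proof (rule transI)
    fix \<tau>\<^sub>1 \<tau>\<^sub>2 \<tau>\<^sub>3
    assume "(\<tau>\<^sub>1, \<tau>\<^sub>2) \<in> embedding_iso_rel G g" "(\<tau>\<^sub>2, \<tau>\<^sub>3) \<in> embedding_iso_rel G g"
    then show "(\<tau>\<^sub>1, \<tau>\<^sub>3) \<in> embedding_iso_rel G g"
      using isomorphic_embeddings_trans[of G \<tau>\<^sub>1 \<tau>\<^sub>2 \<tau>\<^sub>3] by (simp add: embedding_iso_rel_def)
  qed
qed

section \<open>The multigraphs $\Theta_n$\<close>

datatype theta_vertex = U | V

definition Theta :: "nat \<Rightarrow> (theta_vertex, nat) multigraph" where
  "Theta n = \<lparr>verts = {U, V}, edges = {..<n}, ends = (\<lambda>_. {U, V})\<rparr>"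

end

theory Submission
  imports Defs
begin

text \<open>By Euler's formula a double torus embedding of \<open>\<Theta>\<^sub>5\<close> has a single face. Writing \<open>a\<close> and \<open>b\<close> for
  the rotations at the two vertices, two face tracing steps starting at \<open>U\<close> apply \<open>a \<circ> b\<close>, so the
  embeddings are the pairs of 5-cycles whose product is a 5-cycle, up to simultaneous conjugation
  and exchange. Normalising \<open>a\<close> to \<open>c = (0 1 2 3 4)\<close> leaves eight candidates for \<open>b\<close>: the powers
  \<open>c\<close>, \<open>c\<^sup>2\<close>, \<open>c\<^sup>3\<close>, and five conjugates of \<open>(0 1 3 4 2)\<close> under powers of \<open>c\<close>. Exchanging the vertices
  identifies \<open>(c, c\<^sup>2)\<close> with \<open>(c, c\<^sup>3)\<close>. The remaining three classes are told apart by whether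
  \<open>a = b\<close> and whether \<open>a\<close> and \<open>b\<close> commute.\<close>

section \<open>Cyclic permutations\<close>

text \<open>A return to \<open>x\<close> after \<open>k\<close> steps would leave at most
  \<open>k\<close> points in its orbit, which is all of \<open>S\<close>.\<close>

lemma cyclic_on_funpow_neq:
  assumes "cyclic_on f S" "x \<in> S" "0 < k" "k < card S"
  shows "(f ^^ k) x \<noteq> x"
proof
  assume "(f ^^ k) x = x"
  then have "orbit f x = (\<lambda>m. (f ^^ m) x) ` {..<k}"
    using orbit_altdef_bounded[of k f x] assms(3) by auto
  moreover have "orbit f x = S" using assms by (simp add: orbit_cyclic_eq3)
  ultimately have "card S \<le> k"
    by (metis card_image_le card_lessThan finite_lessThan)
  with assms(4) show False by simp
qed

text \<open>The iterates before the first return to \<open>x\<close> run through its orbit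
  \<open>S\<close> without repetition, so the return time is \<open>card S\<close>.\<close>

lemma cyclic_on_bij_betw:
  assumes "cyclic_on f S" "x \<in> S"
  shows "bij_betw (\<lambda>k. (f ^^ k) x) {..<card S} S"
    and "(f ^^ card S) x = x"
proof -
  let ?d = "funpow_dist1 f x x"
  have S: "orbit f x = S" using assms by (simp add: orbit_cyclic_eq3)
  then have x: "x \<in> orbit f x" using assms by simp
  have bij: "bij_betw (\<lambda>k. (f ^^ k) x) {..<?d} S"
    using inj_on_funpow_dist1[OF x] orbit_conv_funpow_dist1[OF x] S
    by (simp add: bij_betw_def atLeast0LessThan)
  then have d: "?d = card S" using bij_betw_same_card by fastforce
  from bij show "bij_betw (\<lambda>k. (f ^^ k) x) {..<card S} S" by (simp only: d)
  from funpow_dist1_prop[OF x] show "(f ^^ card S) x = x" by (simp only: d)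
qed

text \<open>Turns cyclicity of a concrete permutation into listing iterates of one point.
  \<open>Suc k\<close> appears because \<open>orbit\<close> contains positive iterates only.\<close>

lemma cyclic_onI_funpow:
  assumes "f permutes S" "x \<in> S" "S \<subseteq> (\<lambda>k. (f ^^ Suc k) x) ` A"
  shows "cyclic_on f S"
proof (rule cyclic_on_singleI[OF assms(2)])
  show "S = orbit f x"
    using permutes_orbit_subset[OF assms(1,2)] assms(3) unfolding orbit_altdef by blast
qed

lemma cyclic_on_conj_inv:
  assumes "\<rho> permutes S" "cyclic_on f S"
  shows "cyclic_on (inv \<rho> \<circ> f \<circ> \<rho>) S"
proof -
  have "cyclic_on (inv \<rho> \<circ> f \<circ> \<rho>) (inv \<rho> ` S)"
    using assms(2) by (rule cyclic_on_image) (simp add: permutes_inverses[OF assms(1)])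
  then show ?thesis by (simp add: permutes_image[OF permutes_inv[OF assms(1)]])
qed

text \<open>Values beyond the list are fixed, as \<open>permutes\<close> demands.\<close>

definition perm_of_list :: "nat list \<Rightarrow> nat \<Rightarrow> nat" where
  "perm_of_list xs i = (if i < length xs then xs ! i else i)"

lemma perm_of_list_permutes:
  assumes "distinct xs" "set xs = {..<length xs}"
  shows "perm_of_list xs permutes {..<length xs}"
proof (rule bij_imp_permutes)
  show "bij_betw (perm_of_list xs) {..<length xs} {..<length xs}"
    using bij_betw_nth[OF assms(1) refl assms(2)[symmetric]]
    by (rule bij_betw_cong[THEN iffD1, rotated]) (simp add: perm_of_list_def)
qed (simp add: perm_of_list_def)

lemma lessThan_5: "{..<5} = {0, 1, 2, 3, 4 :: nat}"
  by auto

lemma perm_of_list_permutes_5: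
  assumes "length xs = 5" "distinct xs" "set xs = {0, 1, 2, 3, 4}"
  shows "perm_of_list xs permutes {..<5}"
  using perm_of_list_permutes[of xs] assms by (simp add: lessThan_5)

text \<open>Relabelling along the cycle, with \<open>i\<close> sent to the \<open>i\<close>-th
  iterate of 0, turns \<open>f\<close> into the shift; the wrap from 4 to 0 is
  \<open>(f ^^ 5) 0 = 0\<close>.\<close>

lemma ex_conj_cyclic_5:
  assumes "cyclic_on f {..<5}"
  obtains \<rho> where "\<rho> permutes {..<5}"
    "\<And>i. i < 5 \<Longrightarrow> f (\<rho> i) = \<rho> (perm_of_list [1, 2, 3, 4, 0] i)"
proof -
  let ?\<rho> = "\<lambda>i. if i < 5 then (f ^^ i) 0 else i"
  have "bij_betw (\<lambda>k. (f ^^ k) 0) {..<5} {..<5}" and f5: "(f ^^ 5) 0 = 0"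
    using cyclic_on_bij_betw[OF assms, of 0] by simp_all
  then have "bij_betw ?\<rho> {..<5} {..<5}"
    by (subst bij_betw_cong[where g = "\<lambda>k. (f ^^ k) 0"]) auto
  then have "?\<rho> permutes {..<5}" by (rule bij_imp_permutes) simp
  moreover have "f (?\<rho> i) = ?\<rho> (perm_of_list [1, 2, 3, 4, 0] i)" if "i < 5" for i
  proof -
    have "i \<in> {0, 1, 2, 3, 4}" using that by auto
    then show ?thesis
      using f5 by (auto simp: perm_of_list_def numeral_eq_Suc)
  qed
  ultimately show thesis by (rule that)
qed

section \<open>Embeddings of $\Theta_n$ as pairs of permutations\<close>

lemma Theta_simps [simp]:
  "verts (Theta n) = {U, V}" "edges (Theta n) = {..<n}" "ends (Theta n) e = {U, V}"
  by (simp_all add: Theta_def)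

lemma UNIV_theta_vertex: "{U, V} = UNIV"
  using theta_vertex.exhaust by auto

lemma incident_edges_Theta [simp]: "incident_edges (Theta n) v = {..<n}"
  by (cases v) (auto simp: incident_edges_def)

lemma darts_Theta: "darts (Theta n) = UNIV \<times> {..<n}"
  by (auto simp: darts_def UNIV_theta_vertex)

lemma face_step_Theta [simp]:
  "face_step (Theta n) \<tau> (U, e) = (V, \<tau> V e)"
  "face_step (Theta n) \<tau> (V, e) = (U, \<tau> U e)"
proof -
  have "{U, V} - {U} = {V}" "{U, V} - {V} = {U}" by auto
  then show "face_step (Theta n) \<tau> (U, e) = (V, \<tau> V e)"
    "face_step (Theta n) \<tau> (V, e) = (U, \<tau> U e)"
    by (simp_all add: face_step_def other_end_def)
qed

lemma rotation_system_Theta: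
  "rotation_system (Theta n) \<tau> \<longleftrightarrow> (\<forall>v. \<tau> v permutes {..<n} \<and> cyclic_on (\<tau> v) {..<n})"
  by (simp add: rotation_system_def UNIV_theta_vertex)

section \<open>Faces and cycles of the two-step map\<close>

lemma funpow_face_step_Theta:
  "(face_step (Theta n) \<tau> ^^ (2 * k)) (U, e) = (U, ((\<tau> U \<circ> \<tau> V) ^^ k) e)"
  by (induction k) simp_all

text \<open>A face leaves U and V alternately, so its darts at U form one cycle of the two-step map
  \<open>?p\<close>.\<close>

lemma card_faces_Theta_eq_1_iff:
  assumes "\<And>v. \<tau> v permutes {..<n}" "n > 0"
  shows "card (faces (Theta n) \<tau>) = 1 \<longleftrightarrow> cyclic_on (\<tau> U \<circ> \<tau> V) {..<n}"
    (is "_ \<longleftrightarrow> cyclic_on ?p _")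
proof
  let ?f = "face_step (Theta n) \<tau>"
  have p: "?p permutes {..<n}" using assms(1) by (simp add: permutes_compose)
  {
    assume "card (faces (Theta n) \<tau>) = 1"
    then obtain F where F: "faces (Theta n) \<tau> = {F}" by (auto simp: card_1_singleton_iff)
    have orb: "orbit ?f (U, e) = F" if "e < n" for e
      using F that by (auto simp: faces_def darts_Theta)
    have "e \<in> orbit ?p 0" if e: "e < n" for e
    proof -
      \<comment> \<open>An orbit starts one step after its base point, so a dart lies on its own
        face only because \<open>?p\<close> returns to \<open>e\<close>.\<close>
      have "e \<in> orbit ?p e"
        using p by (intro permutation_self_in_orbit) (auto simp: permutation_permutes)
      then obtain k where "0 < k" "(?p ^^ k) e = e" by (auto simp: orbit_altdef)
      then have "(U, e) \<in> orbit ?f (U, e)"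
        using funpow_face_step_Theta[where n = n and \<tau> = \<tau> and k = k and e = e]
        by (auto simp: orbit_altdef intro!: exI[of _ "2 * k"])
      then have "(U, e) \<in> orbit ?f (U, 0)" using orb[OF e] orb[OF assms(2)] by simp
      then obtain m where m: "0 < m" "(?f ^^ m) (U, 0) = (U, e)" by (auto simp: orbit_altdef)
      show ?thesis
      proof (cases "even m")
        case True
        then obtain j where "m = 2 * j" by blast
        with m show ?thesis by (auto simp: funpow_face_step_Theta orbit_altdef)
      next
        case False
        then obtain j where j: "m = Suc (2 * j)" by (auto elim: oddE)
        \<comment> \<open>An odd number of steps from U ends at V, so this case is
          contradictory.\<close>
        have "(?f ^^ m) (U, 0) = ?f ((?f ^^ (2 * j)) (U, 0))" unfolding j by simp
        with m show ?thesis unfolding funpow_face_step_Theta by simp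
      qed
    qed
    then have "{..<n} = orbit ?p 0"
      using permutes_orbit_subset[OF p, of 0] assms(2) by auto
    then show "cyclic_on ?p {..<n}" using assms(2) by (auto intro!: cyclic_on_singleI)
  }
  {
    assume cyc: "cyclic_on ?p {..<n}"
    have U: "orbit ?f (U, e) \<supseteq> darts (Theta n)" if e: "e < n" for e
    proof -
      have *: "(U, x) \<in> orbit ?f (U, e)" if "x < n" for x
      proof -
        have "x \<in> orbit ?p e" using orbit_cyclic_eq3[OF cyc] e that by simp
        then obtain k where "0 < k" "(?p ^^ k) e = x" by (auto simp: orbit_altdef)
        then show ?thesis
          using funpow_face_step_Theta[where n = n and \<tau> = \<tau> and k = k and e = e]
          by (auto simp: orbit_altdef intro!: exI[of _ "2 * k"])
      qed
      moreover have "(V, y) \<in> orbit ?f (U, e)" if "y < n" for y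
      proof -
        \<comment> \<open>Each dart at V is the successor of a dart at U.\<close>
        have "y \<in> \<tau> V ` {..<n}" using that permutes_image[OF assms(1)] by simp
        then obtain x where "x < n" "y = \<tau> V x" by auto
        then show ?thesis using orbit.step[OF *, of x] by simp
      qed
      ultimately have "(v, x) \<in> orbit ?f (U, e)" if "x < n" for v x
        using that by (cases v) auto
      then show ?thesis by (auto simp: darts_Theta)
    qed
    have less: "\<tau> v e < n \<longleftrightarrow> e < n" for v e using permutes_in_image[OF assms(1)[of v]] by simp
    have "orbit ?f (v, e) = darts (Theta n)" if "e < n" for v e
    proof
      show "darts (Theta n) \<subseteq> orbit ?f (v, e)"
      proof (cases v)
        case V
        \<comment> \<open>One step from V reaches U, where the orbit is already known to be
          everything.\<close>
        have "darts (Theta n) \<subseteq> orbit ?f (?f (V, e))" using U[of "\<tau> U e"] that less by simp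
        then show ?thesis unfolding V using orbit_subset by fast
      qed (use U that in simp)
      have "snd d < n" if "d \<in> orbit ?f (v, e)" for d
        using that
      proof induction
        case base
        show ?case using \<open>e < n\<close> less by (cases v) simp_all
      next
        case (step y)
        obtain w x where "y = (w, x)" by (cases y)
        with step show ?case using less by (cases w) simp_all
      qed
      then show "orbit ?f (v, e) \<subseteq> darts (Theta n)" by (auto simp: darts_Theta)
    qed
    then have "faces (Theta n) \<tau> = {darts (Theta n)}"
      using assms(2) by (auto simp: faces_def darts_Theta image_iff)
    then show "card (faces (Theta n) \<tau>) = 1" by simp
  }
qed

lemma loopless_Theta: "loopless_multigraph (Theta n)"
  by (simp add: loopless_multigraph_def)

lemma connected_Theta: "n > 0 \<Longrightarrow> connected_multigraph (Theta n)"
  by (auto simp: connected_multigraph_def insert_commute intro!: r_into_rtrancl)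

lemma embeddings_Theta_5:
  "\<tau> \<in> embeddings (Theta 5) 2 \<longleftrightarrow>
     (\<forall>v. \<tau> v permutes {..<5} \<and> cyclic_on (\<tau> v) {..<5}) \<and> cyclic_on (\<tau> U \<circ> \<tau> V) {..<5}"
proof -
  have "\<tau> \<in> embeddings (Theta 5) 2 \<longleftrightarrow>
      rotation_system (Theta 5) \<tau> \<and> card (faces (Theta 5) \<tau>) = 1"
    \<comment> \<open>With \<open>F\<close> faces, 2 - 5 + \<open>F\<close> = 2 - 4 forces
      \<open>F\<close> = 1.\<close>
    by (auto simp: embeddings_def two_cell_embedding_def loopless_Theta connected_Theta)
  then show ?thesis
    using card_faces_Theta_eq_1_iff[of \<tau> 5] by (auto simp: rotation_system_Theta)
qed

section \<open>Isomorphism criteria and invariants\<close>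

lemma isomorphic_embeddings_ThetaI:
  assumes "\<rho> permutes {..<n}" "\<And>v e. e < n \<Longrightarrow> \<sigma> v (\<rho> e) = \<rho> (\<tau> v e)"
  shows "isomorphic_embeddings (Theta n) \<tau> \<sigma>"
  unfolding isomorphic_embeddings_def
  using assms by (intro exI[of _ id] exI[of _ \<rho>]) (simp add: permutes_id)

lemma isomorphic_embeddings_Theta_swapI:
  assumes "\<rho> permutes {..<n}"
    "\<And>e. e < n \<Longrightarrow> \<sigma> V (\<rho> e) = \<rho> (\<tau> U e)" "\<And>e. e < n \<Longrightarrow> \<sigma> U (\<rho> e) = \<rho> (\<tau> V e)"
  shows "isomorphic_embeddings (Theta n) \<tau> \<sigma>"
  unfolding isomorphic_embeddings_def
  using assms by (intro exI[of _ "transpose U V"] exI[of _ \<rho>])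
    (auto simp: permutes_swap_id)

text \<open>Here \<open>v\<close> and \<open>w\<close> are the images of U and V, which covers
  fixing and exchanging the vertices at once.\<close>

lemma isomorphic_embeddings_ThetaE:
  assumes "isomorphic_embeddings (Theta n) \<tau> \<sigma>"
  obtains \<rho> v w where "\<rho> permutes {..<n}" "{v, w} = {U, V}"
    "\<And>e. e < n \<Longrightarrow> \<sigma> v (\<rho> e) = \<rho> (\<tau> U e)" "\<And>e. e < n \<Longrightarrow> \<sigma> w (\<rho> e) = \<rho> (\<tau> V e)"
proof (rule isomorphic_embeddingsE[OF assms], unfold Theta_simps incident_edges_Theta)
  fix \<pi> \<rho>
  assume "\<pi> permutes {U, V}" "\<rho> permutes {..<n}" "\<And>e. e \<in> {..<n} \<Longrightarrow> {U, V} = \<pi> ` {U, V}"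
    "\<And>v e. v \<in> {U, V} \<Longrightarrow> e \<in> {..<n} \<Longrightarrow> \<sigma> (\<pi> v) (\<rho> e) = \<rho> (\<tau> v e)"
  moreover from this(1) have "{\<pi> U, \<pi> V} = {U, V}" using permutes_image[of \<pi> "{U, V}"] by simp
  ultimately show thesis by (intro that[of \<rho> "\<pi> U" "\<pi> V"]) simp_all
qed

text \<open>An invariant: equality of the two rotations survives relabelling and is symmetric in the
  vertices.\<close>

lemma isomorphic_embeddings_Theta_eq:
  assumes "isomorphic_embeddings (Theta n) \<tau> \<sigma>" "\<And>v. \<sigma> v permutes {..<n}"
    and eq: "\<And>e. e < n \<Longrightarrow> \<tau> U e = \<tau> V e"
    and "e < n"
  shows "\<sigma> U e = \<sigma> V e"
proof (rule isomorphic_embeddings_ThetaE[OF assms(1)])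
  fix \<rho> v w
  assume \<rho>: "\<rho> permutes {..<n}" and vw: "{v, w} = {U, V}"
    and "\<And>e. e < n \<Longrightarrow> \<sigma> v (\<rho> e) = \<rho> (\<tau> U e)" "\<And>e. e < n \<Longrightarrow> \<sigma> w (\<rho> e) = \<rho> (\<tau> V e)"
  moreover obtain i where "i < n" "e = \<rho> i"
    using permutes_image[OF \<rho>] \<open>e < n\<close> by (metis imageE lessThan_iff)
  ultimately have "\<sigma> v e = \<sigma> w e" using eq by simp
  with vw show ?thesis by (auto simp: doubleton_eq_iff)
qed

text \<open>The second invariant, preserved for the same reason.\<close>

lemma isomorphic_embeddings_Theta_commute:
  assumes "isomorphic_embeddings (Theta n) \<tau> \<sigma>" "\<And>v. \<tau> v permutes {..<n}"
    and comm: "\<And>e. e < n \<Longrightarrow> \<tau> U (\<tau> V e) = \<tau> V (\<tau> U e)"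
    and "e < n"
  shows "\<sigma> U (\<sigma> V e) = \<sigma> V (\<sigma> U e)"
proof (rule isomorphic_embeddings_ThetaE[OF assms(1)])
  fix \<rho> v w
  assume \<rho>: "\<rho> permutes {..<n}" and vw: "{v, w} = {U, V}"
    and "\<And>e. e < n \<Longrightarrow> \<sigma> v (\<rho> e) = \<rho> (\<tau> U e)" "\<And>e. e < n \<Longrightarrow> \<sigma> w (\<rho> e) = \<rho> (\<tau> V e)"
  moreover obtain i where "i < n" "e = \<rho> i"
    using permutes_image[OF \<rho>] \<open>e < n\<close> by (metis imageE lessThan_iff)
  moreover have "\<tau> x j < n" if "j < n" for x j
    using that permutes_in_image[OF assms(2)] by (metis lessThan_iff)
  ultimately have "\<sigma> v (\<sigma> w e) = \<sigma> w (\<sigma> v e)" using comm by simp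
  with vw show ?thesis by (auto simp: doubleton_eq_iff)
qed

section \<open>Classification for $n = 5$\<close>

text \<open>Lists are in one-line notation: \<open>[1, 3, 0, 4, 2]\<close> stands for the cycle \<open>(0 1 3 4 2)\<close>.\<close>

definition theta_rotation :: "nat list \<Rightarrow> theta_vertex \<Rightarrow> nat \<Rightarrow> nat" where
  "theta_rotation xs = case_theta_vertex (perm_of_list [1, 2, 3, 4, 0]) (perm_of_list xs)"

lemma theta_rotation_simps [simp]:
  "theta_rotation xs U = perm_of_list [1, 2, 3, 4, 0]"
  "theta_rotation xs V = perm_of_list xs"
  by (simp_all add: theta_rotation_def)

text \<open>A finite search over the 24 five-cycles \<open>f\<close> = (0 \<open>x1\<close>
  \<open>x2\<close> \<open>x3\<close> \<open>x4\<close>). The product is tested only by 0 not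
  recurring among its first four iterates.\<close>

lemma five_cycle_products:
  assumes f: "f permutes {..<5}" "cyclic_on f {..<5}"
    and c: "cyclic_on (perm_of_list [1, 2, 3, 4, 0] \<circ> f) {..<5}"
  shows "map f [0, 1, 2, 3, 4] \<in>
    {[1, 2, 3, 4, 0], [2, 3, 4, 0, 1], [3, 4, 0, 1, 2], [1, 3, 0, 4, 2], [3, 2, 4, 1, 0],
     [1, 4, 3, 0, 2], [3, 2, 0, 4, 1], [2, 4, 3, 1, 0]}"
proof -
  define p where "p = perm_of_list [1, 2, 3, 4, 0] \<circ> f"
  define x1 x2 x3 x4 where x: "x1 = f 0" "x2 = f x1" "x3 = f x2" "x4 = f x3"
  have bij: "bij_betw (\<lambda>k. (f ^^ k) 0) {..<5} {..<5}" and f5: "(f ^^ 5) 0 = 0"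
    using cyclic_on_bij_betw[OF f(2), of 0] by simp_all
  have "(\<lambda>k. (f ^^ k) 0) ` {..<5} = {..<5}" using bij by (simp add: bij_betw_def)
  then have S: "{0, x1, x2, x3, x4} = {0, 1, 2, 3, 4}"
    unfolding lessThan_5 by (simp add: x numeral_eq_Suc)
  have fx: "f 0 = x1" "f x1 = x2" "f x2 = x3" "f x3 = x4" "f x4 = 0"
    using f5 by (simp_all add: x numeral_eq_Suc)
  have "(p ^^ k) 0 \<noteq> 0" if "k \<in> {1, 2, 3, 4}" for k
    using cyclic_on_funpow_neq[OF c, of 0 k] that unfolding p_def by auto
  from this[of 1] this[of 2] this[of 3] this[of 4]
  have p0: "p 0 \<noteq> 0" "p (p 0) \<noteq> 0" "p (p (p 0)) \<noteq> 0" "p (p (p (p 0))) \<noteq> 0"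
    by (simp_all add: numeral_eq_Suc)
  have "card {0, x1, x2, x3, x4} = 5" unfolding S by simp
  then have dist: "distinct [0, x1, x2, x3, x4]"
    by (intro card_distinct) simp
  have "{x1, x2, x3, x4} \<subseteq> {0, 1, 2, 3, 4} - {0}"
    unfolding S[symmetric] using dist by auto
  then have mem: "x1 \<in> {1, 2, 3, 4}" "x2 \<in> {1, 2, 3, 4}" "x3 \<in> {1, 2, 3, 4}" "x4 \<in> {1, 2, 3, 4}"
    by blast+
  have p: "p i = perm_of_list [1, 2, 3, 4, 0] (f i)" for i
    by (simp add: p_def)
  have c_simps: "perm_of_list [1, 2, 3, 4, 0] 0 = 1" "perm_of_list [1, 2, 3, 4, 0] 1 = 2"
    "perm_of_list [1, 2, 3, 4, 0] 2 = 3" "perm_of_list [1, 2, 3, 4, 0] 3 = 4"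
    "perm_of_list [1, 2, 3, 4, 0] 4 = 0"
    by (simp_all add: perm_of_list_def)
  \<comment> \<open>Of the 256 choices for \<open>x1\<close>, ..., \<open>x4\<close>,
    \<open>dist\<close> removes those with repetitions and \<open>p0\<close> those with a short
    cycle of \<open>p\<close> through 0.\<close>
  from mem dist fx p0 show ?thesis
    by (elim insertE emptyE) (simp_all add: p c_simps[unfolded One_nat_def])
qed

lemma ex_iso_theta_rotation:
  assumes "\<tau> \<in> embeddings (Theta 5) 2"
  shows "\<exists>xs \<in> {[1, 2, 3, 4, 0], [2, 3, 4, 0, 1], [1, 3, 0, 4, 2]}.
    isomorphic_embeddings (Theta 5) (theta_rotation xs) \<tau>"
proof -
  let ?c = "perm_of_list [1, 2, 3, 4, 0]"
  have \<tau>: "\<tau> v permutes {..<5}" "cyclic_on (\<tau> v) {..<5}" for v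
    using assms by (simp_all add: embeddings_Theta_5)
  have UV: "cyclic_on (\<tau> U \<circ> \<tau> V) {..<5}"
    using assms by (simp_all add: embeddings_Theta_5)
  obtain \<rho> where \<rho>: "\<rho> permutes {..<5}" and \<rho>U: "\<And>i. i < 5 \<Longrightarrow> \<tau> U (\<rho> i) = \<rho> (?c i)"
    using ex_conj_cyclic_5[OF \<tau>(2)] by blast
  \<comment> \<open>\<open>b\<close> is the rotation at V in the edge labels that make the rotation
    at U equal to \<open>?c\<close>.\<close>
  define b where "b = inv \<rho> \<circ> \<tau> V \<circ> \<rho>"
  have b: "b permutes {..<5}"
    unfolding b_def by (intro permutes_compose \<rho> permutes_inv \<tau>)
  have \<rho>V: "\<tau> V (\<rho> i) = \<rho> (b i)" for i
    by (simp add: b_def permutes_inverses[OF \<rho>])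
  have "cyclic_on b {..<5}"
    unfolding b_def by (intro cyclic_on_conj_inv \<rho> \<tau>)
  moreover have "cyclic_on (?c \<circ> b) {..<5}"
  proof -
    \<comment> \<open>Conjugation by \<rho> carries the product to \<open>?c \<circ> b\<close>;
      \<open>\<rho>U\<close> gives this on labels below 5, which suffices for
      \<open>cyclic_cong\<close>.\<close>
    have "(inv \<rho> \<circ> (\<tau> U \<circ> \<tau> V) \<circ> \<rho>) i = (?c \<circ> b) i" if "i < 5" for i
      using that \<rho>U permutes_in_image[OF b, of i]
      by (simp add: \<rho>V permutes_inverses[OF \<rho>])
    with cyclic_on_conj_inv[OF \<rho> UV] show ?thesis
      by (subst (asm) cyclic_cong) auto
  qed
  ultimately have "map b [0, 1, 2, 3, 4] \<in>
    {[1, 2, 3, 4, 0], [2, 3, 4, 0, 1], [3, 4, 0, 1, 2], [1, 3, 0, 4, 2], [3, 2, 4, 1, 0],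
     [1, 4, 3, 0, 2], [3, 2, 0, 4, 1], [2, 4, 3, 1, 0]}" (is "?bs \<in> _")
    by (rule five_cycle_products[OF b])
  moreover have iso: "isomorphic_embeddings (Theta 5) (theta_rotation ?bs) \<tau>"
  proof (rule isomorphic_embeddings_ThetaI[OF \<rho>])
    fix v e assume e: "e < (5 :: nat)"
    then have "e \<in> {0, 1, 2, 3, 4}" by auto
    then have "perm_of_list ?bs e = b e" by (auto simp: perm_of_list_def)
    with e show "\<tau> v (\<rho> e) = \<rho> (theta_rotation ?bs v e)"
      by (cases v) (simp_all add: \<rho>U \<rho>V)
  qed
  \<comment> \<open>Each \<open>r\<close> is a power of \<open>c\<close>, so conjugating by it keeps
    the rotation at U and changes only the one at V.\<close>
  moreover have conj: "isomorphic_embeddings (Theta 5) (theta_rotation [1, 3, 0, 4, 2]) (theta_rotation ys)"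
    if "(ys, r) \<in> {([3, 2, 4, 1, 0], [1, 2, 3, 4, 0]), ([1, 4, 3, 0, 2], [2, 3, 4, 0, 1]),
      ([3, 2, 0, 4, 1], [3, 4, 0, 1, 2]), ([2, 4, 3, 1, 0], [4, 0, 1, 2, 3])}" for ys r :: "nat list"
  proof (rule isomorphic_embeddings_ThetaI)
    show "perm_of_list r permutes {..<5}"
      using that by (intro perm_of_list_permutes_5) auto
    fix v e assume "e < (5 :: nat)"
    then have "e \<in> {0, 1, 2, 3, 4}" by auto
    with that show "theta_rotation ys v (perm_of_list r e) =
        perm_of_list r (theta_rotation [1, 3, 0, 4, 2] v e)"
      by (cases v) (auto simp: perm_of_list_def)
  qed
  \<comment> \<open>The witness \<open>[0, 3, 1, 4, 2]\<close> is multiplication by 3 modulo 5. It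
    conjugates \<open>c\<close> to \<open>c^3\<close> and \<open>c^2\<close> to
    \<open>c^6 = c\<close>, so exchanging the vertices turns \<open>(c, c^2)\<close> into
    \<open>(c, c^3)\<close>.\<close>
  moreover have swap:
    "isomorphic_embeddings (Theta 5) (theta_rotation [2, 3, 4, 0, 1]) (theta_rotation [3, 4, 0, 1, 2])"
  proof (rule isomorphic_embeddings_Theta_swapI)
    show "perm_of_list [0, 3, 1, 4, 2] permutes {..<5}"
      by (intro perm_of_list_permutes_5) auto
    fix e assume "e < (5 :: nat)"
    then have e: "e \<in> {0, 1, 2, 3, 4}" by auto
    then show "theta_rotation [3, 4, 0, 1, 2] V (perm_of_list [0, 3, 1, 4, 2] e) =
        perm_of_list [0, 3, 1, 4, 2] (theta_rotation [2, 3, 4, 0, 1] U e)"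
      by (auto simp: perm_of_list_def)
    from e show "theta_rotation [3, 4, 0, 1, 2] U (perm_of_list [0, 3, 1, 4, 2] e) =
        perm_of_list [0, 3, 1, 4, 2] (theta_rotation [2, 3, 4, 0, 1] V e)"
      by (auto simp: perm_of_list_def)
  qed
  ultimately have
    "\<exists>xs \<in> {[1, 2, 3, 4, 0], [2, 3, 4, 0, 1], [1, 3, 0, 4, 2]}.
      isomorphic_embeddings (Theta 5) (theta_rotation xs) (theta_rotation ?bs)"
    unfolding insert_iff
    by (elim disjE) (simp_all only:, auto intro: isomorphic_embeddings_refl)
  with iso show ?thesis
    by (blast intro: isomorphic_embeddings_trans)
qed

section \<open>The three representatives\<close>

lemma theta_rotation_in_embeddings:
  assumes "xs \<in> {[1, 2, 3, 4, 0], [2, 3, 4, 0, 1], [1, 3, 0, 4, 2]}"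
  shows "theta_rotation xs \<in> embeddings (Theta 5) 2"
proof -
  have perm: "perm_of_list ys permutes {..<5}"
    if "ys \<in> {[1, 2, 3, 4, 0], [2, 3, 4, 0, 1], [1, 3, 0, 4, 2]}" for ys
    using that by (intro perm_of_list_permutes_5) auto
  \<comment> \<open>The iterates listed are the first to the fifth; the fifth has to supply 0
    itself.\<close>
  have sub: "{..<5} \<subseteq> (\<lambda>k. (f ^^ Suc k) 0) ` {..<5}"
    if "{0, 1, 2, 3, 4} \<subseteq> {f 0, f (f 0), f (f (f 0)), f (f (f (f 0))), f (f (f (f (f 0))))}"
    for f :: "nat \<Rightarrow> nat"
    using that unfolding lessThan_5 by (simp add: numeral_eq_Suc)
  have cyc: "cyclic_on (perm_of_list ys) {..<5}"
    if "ys \<in> {[1, 2, 3, 4, 0], [2, 3, 4, 0, 1], [1, 3, 0, 4, 2]}" for ys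
    using that
    by (intro cyclic_onI_funpow[OF perm[OF that] _ sub]; elim insertE emptyE)
      (simp_all add: perm_of_list_def)
  have "perm_of_list [1, 2, 3, 4, 0] \<circ> perm_of_list xs permutes {..<5}"
    using assms by (intro permutes_compose[OF perm perm]) auto
  then have "cyclic_on (perm_of_list [1, 2, 3, 4, 0] \<circ> perm_of_list xs) {..<5}"
    using assms
    by (intro cyclic_onI_funpow[OF _ _ sub]; elim insertE emptyE)
      (simp_all add: perm_of_list_def)
  moreover have "theta_rotation xs v permutes {..<5} \<and> cyclic_on (theta_rotation xs v) {..<5}" for v
    using assms perm cyc by (cases v) auto
  ultimately show ?thesis by (simp add: embeddings_Theta_5)
qed

theorem theorem1:
  shows "card (embeddings (Theta 5) 2 // embedding_iso_rel (Theta 5) 2) = 3"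
proof -
  let ?E = "embeddings (Theta 5) 2" and ?R = "embedding_iso_rel (Theta 5) 2"
  let ?iso = "isomorphic_embeddings (Theta 5)"
  let ?r = theta_rotation
  let ?a = "[1, 2, 3, 4, 0]" and ?b = "[2, 3, 4, 0, 1]" and ?d = "[1, 3, 0, 4, 2]"
  have E: "?r ?a \<in> ?E" "?r ?b \<in> ?E" "?r ?d \<in> ?E"
    by (simp_all add: theta_rotation_in_embeddings)
  have perm: "\<tau> v permutes {..<5}" if "\<tau> \<in> ?E" for \<tau> v
    using that by (simp add: embeddings_Theta_5)
  have class_eq: "?R `` {\<sigma>} = ?R `` {\<tau>} \<longleftrightarrow> ?iso \<sigma> \<tau>" if "\<sigma> \<in> ?E" "\<tau> \<in> ?E" for \<sigma> \<tau>
    using eq_equiv_class_iff[OF equiv_embedding_iso_rel that] that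
    by (simp add: embedding_iso_rel_def)
  have "?E // ?R = {?R `` {?r ?a}, ?R `` {?r ?b}, ?R `` {?r ?d}}"
  proof
    show "?E // ?R \<subseteq> {?R `` {?r ?a}, ?R `` {?r ?b}, ?R `` {?r ?d}}"
    proof
      fix X assume "X \<in> ?E // ?R"
      then obtain \<tau> where \<tau>: "\<tau> \<in> ?E" "X = ?R `` {\<tau>}" by (auto elim: quotientE)
      then have "?iso (?r ?a) \<tau> \<or> ?iso (?r ?b) \<tau> \<or> ?iso (?r ?d) \<tau>"
        using ex_iso_theta_rotation by blast
      with \<tau> E show "X \<in> {?R `` {?r ?a}, ?R `` {?r ?b}, ?R `` {?r ?d}}"
        using class_eq by blast
    qed
  qed (use E in \<open>auto intro: quotientI\<close>)
  moreover have "\<not> ?iso (?r ?a) (?r ?b)" "\<not> ?iso (?r ?a) (?r ?d)"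
    \<comment> \<open>Only \<open>?r ?a\<close> has equal rotations. \<open>?b\<close> differs from
      the shift at edge 0, whereas \<open>?d\<close> agrees with it there and first differs at edge
      1.\<close>
    using isomorphic_embeddings_Theta_eq[of 5 "?r ?a" "?r ?b" 0]
      isomorphic_embeddings_Theta_eq[of 5 "?r ?a" "?r ?d" 1] perm E
    by (auto simp: perm_of_list_def)
  moreover have "\<not> ?iso (?r ?b) (?r ?d)"
  proof
    assume iso: "?iso (?r ?b) (?r ?d)"
    have "?r ?b U (?r ?b V e) = ?r ?b V (?r ?b U e)" if "e < 5" for e
    proof -
      have "e \<in> {0, 1, 2, 3, 4}" using that by auto
      then show ?thesis by (auto simp: perm_of_list_def)
    qed
    \<comment> \<open>The rotations of \<open>?r ?b\<close> are powers of \<open>c\<close> and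
      commute; those of \<open>?r ?d\<close> send edge 0 to 2 in one order and to 3 in the
      other.\<close>
    from isomorphic_embeddings_Theta_commute[OF iso perm[OF E(2)] this, of 0]
    show False by (simp add: perm_of_list_def)
  qed
  ultimately show ?thesis
    using E by (simp add: class_eq)
qed

end
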